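(* For every integer $n\ge 6$, $$m_2^{-}(n,3)\le\begin{cases} n(n-2)/2, & \text{if } n \text{ is even},\\ (n-1)(n-2)/2, & \text{if } n \text{ is odd}.\end{cases}$$
   Context: The Johnson graph $J(n,3)$ has as vertices the $3$-element subsets of $\{1,\ldots,n\}$, adjacent iff their intersection has size $2$. $V_2$ is the eigenspace of its adjacency matrix for the eigenvalue $\lambda_2(n,3)=n-7$. For a real vector $v$ indexed by vertices, $X_-(v)=\{x:v_x<0\}$, $X_0(v)=\{x:v_x=0\}$, and $m_2^-(n,3)=\min\{|X_-(v)|: v\in V_2,\ X_0(v)=\emptyset\}$. *)

theory Defs
  imports Complex_Main "HOL-Library.FuncSet"
begin

definition johnson_vertices :: "nat \<Rightarrow> nat set set" where
  "johnson_vertices n = {x. x \<subseteq> {1..n} \<and> card x = 3}"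

definition johnson_adjacent :: "nat set \<Rightarrow> nat set \<Rightarrow> bool" where
  "johnson_adjacent x y \<longleftrightarrow> card (x \<inter> y) = 2"

definition adjacency_matrix :: "nat set \<Rightarrow> nat set \<Rightarrow> real" where
  "adjacency_matrix x y = (if johnson_adjacent x y then 1 else 0)"

text \<open>Real vectors indexed by the vertices are the functions in
  \<open>extensional (johnson_vertices n)\<close>, so that they are determined by their entries.\<close>

definition johnson_eigenspace :: "nat \<Rightarrow> real \<Rightarrow> (nat set \<Rightarrow> real) set" where
  "johnson_eigenspace n \<mu> =
    {v \<in> extensional (johnson_vertices n).
      \<forall>x\<in>johnson_vertices n.
        (\<Sum>y\<in>johnson_vertices n. adjacency_matrix x y * v y) = \<mu> * v x}"

definition V2 :: "nat \<Rightarrow> (nat set \<Rightarrow> real) set" where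
  "V2 n = johnson_eigenspace n (real n - 7)"

definition X_neg :: "nat \<Rightarrow> (nat set \<Rightarrow> real) \<Rightarrow> nat set set" where
  "X_neg n v = {x \<in> johnson_vertices n. v x < 0}"

definition X_zero :: "nat \<Rightarrow> (nat set \<Rightarrow> real) \<Rightarrow> nat set set" where
  "X_zero n v = {x \<in> johnson_vertices n. v x = 0}"

text \<open>The set below is finite, its elements being at most \<open>card (johnson_vertices n)\<close>.
  As \<open>Min {}\<close> is unspecified, a bound on \<open>m2_neg n\<close> is informative only if
  some vector of \<open>V2 n\<close> has no zero entry; an infimum would be \<open>0\<close> in the empty case.\<close>

definition m2_neg :: "nat \<Rightarrow> nat" where
  "m2_neg n = Min {card (X_neg n v) | v. v \<in> V2 n \<and> X_zero n v = {}}"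

end

theory Submission
  imports Defs
begin

text \<open>
  A weighting \<open>g\<close> of the edges of the complete graph on \<open>{1..n}\<close> whose sum at every point is zero
  induces a vector of \<open>V2 n\<close>: give each triple the total weight of its three edges. Take a
  matching with \<open>m\<close> edges, where \<open>n = 2 * m\<close> or \<open>n = 2 * m + 1\<close>, give the matching edges the
  weight \<open>2 - 2 * m\<close>, the other edges between matched points the weight \<open>1\<close>, and the edges at the
  unmatched point (if there is one) the weight \<open>0\<close>. For \<open>m \<ge> 3\<close> no triple has weight zero, and the
  negative triples are those containing a matching edge, of which there are \<open>m * (n - 2)\<close>.
\<close>

section \<open>Weights of triples and their change under an exchange\<close>

text \<open>As a sum over ordered pairs, this is twice the total edge weight of \<open>x\<close>.\<close>

definition pair_weight :: "('a \<Rightarrow> 'a \<Rightarrow> real) \<Rightarrow> 'a set \<Rightarrow> real" where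
  "pair_weight g x = (\<Sum>a\<in>x. \<Sum>b\<in>x. g a b)"

lemma johnson_vertices_finite [simp]: "finite (johnson_vertices n)"
  by (rule finite_subset[of _ "Pow {1..n}"]) (auto simp: johnson_vertices_def)

lemma pair_weight_insert:
  assumes "finite x" "d \<notin> x" "\<And>a b. g a b = g b a" "\<And>a. g a a = 0"
  shows "pair_weight g (insert d x) = pair_weight g x + 2 * (\<Sum>q\<in>x. g d q)"
proof -
  have "(\<Sum>q\<in>x. g q d) = (\<Sum>q\<in>x. g d q)"
    by (rule sum.cong) (use assms in auto)
  then show ?thesis
    using assms by (simp add: pair_weight_def sum.distrib)
qed

lemma pair_weight_triple:
  assumes "a \<noteq> b" "a \<noteq> c" "b \<noteq> c" "\<And>a b. g a b = g b a" "\<And>a. g a a = 0"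
  shows "pair_weight g {a, b, c} = 2 * (g a b + g a c + g b c)"
  using assms by (simp add: pair_weight_insert) (simp add: pair_weight_def assms(5))

text \<open>Both sums run over all of \<open>x\<close>, so that they can later be summed over
  \<open>p\<close> and \<open>d\<close> separately. The diagonal vanishes, so keeping
  \<open>q = p\<close> costs nothing in the first sum; in the second it adds \<open>g d p\<close>,
  which the last term removes.\<close>

lemma pair_weight_exchange:
  assumes "finite x" "p \<in> x" "d \<notin> x" "\<And>a b. g a b = g b a" "\<And>a. g a a = 0"
  shows "pair_weight g (insert d (x - {p})) =
    pair_weight g x - 2 * (\<Sum>q\<in>x. g p q) + 2 * (\<Sum>q\<in>x. g d q) - 2 * g p d"
proof -
  have x: "insert p (x - {p}) = x"
    using assms by auto
  have "pair_weight g x = pair_weight g (x - {p}) + 2 * (\<Sum>q\<in>x - {p}. g p q)"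
    using pair_weight_insert[of "x - {p}" p g] assms x by simp
  moreover have "pair_weight g (insert d (x - {p})) =
      pair_weight g (x - {p}) + 2 * (\<Sum>q\<in>x - {p}. g d q)"
    by (rule pair_weight_insert) (use assms in auto)
  moreover have "(\<Sum>q\<in>x - {p}. g p q) = (\<Sum>q\<in>x. g p q)"
    "(\<Sum>q\<in>x - {p}. g d q) = (\<Sum>q\<in>x. g d q) - g p d"
    using assms by (simp_all add: sum_diff1)
  ultimately show ?thesis
    by simp
qed

section \<open>Neighbours of a vertex and the eigenvalue equation\<close>

text \<open>A neighbour \<open>y\<close> of \<open>x\<close> trades one point \<open>p\<close> for
  one outside point \<open>d\<close>, and the pair is recovered from \<open>x - y\<close> and
  \<open>y - x\<close>. This turns the adjacency sum into a double sum over \<open>p\<close> and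
  \<open>d\<close>.\<close>

lemma johnson_neighbours_bij_betw:
  assumes "x \<in> johnson_vertices n"
  shows "bij_betw (\<lambda>(p, d). insert d (x - {p})) (x \<times> ({1..n} - x))
    {y \<in> johnson_vertices n. johnson_adjacent x y}"
proof -
  have x: "x \<subseteq> {1..n}" "card x = 3" "finite x"
    using assms by (auto simp: johnson_vertices_def intro: card_ge_0_finite)
  show ?thesis
  proof (rule bij_betw_imageI)
    show "inj_on (\<lambda>(p, d). insert d (x - {p})) (x \<times> ({1..n} - x))"
    proof (rule inj_on_inverseI[where g = "\<lambda>y. (the_elem (x - y), the_elem (y - x))"])
      fix z assume "z \<in> x \<times> ({1..n} - x)"
      then obtain p d where z: "z = (p, d)" "p \<in> x" "d \<notin> x"
        by auto
      then have "x - insert d (x - {p}) = {p}" "insert d (x - {p}) - x = {d}"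
        by auto
      then show "(\<lambda>y. (the_elem (x - y), the_elem (y - x)))
          ((\<lambda>(p, d). insert d (x - {p})) z) = z"
        using z(1) by simp
    qed
  next
    show "(\<lambda>(p, d). insert d (x - {p})) ` (x \<times> ({1..n} - x)) =
        {y \<in> johnson_vertices n. johnson_adjacent x y}" (is "?L = ?R")
    proof
      show "?L \<subseteq> ?R"
      proof
        fix y assume "y \<in> ?L"
        then obtain p d where y: "p \<in> x" "d \<in> {1..n}" "d \<notin> x" "y = insert d (x - {p})"
          by auto
        then have "x \<inter> y = x - {p}"
          by auto
        then show "y \<in> ?R"
          using x y by (auto simp: johnson_vertices_def johnson_adjacent_def)
      qed
    next
      show "?R \<subseteq> ?L"
      proof
        fix y assume "y \<in> ?R"
        then have y: "y \<subseteq> {1..n}" "card y = 3" "card (x \<inter> y) = 2" "finite y"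
          by (auto simp: johnson_vertices_def johnson_adjacent_def intro: card_ge_0_finite)
        have "card (x - y) = 1" "card (y - x) = 1"
          using x y by (simp_all add: card_Diff_subset_Int Int_commute)
        then obtain p d where "x - y = {p}" "y - x = {d}"
          by (auto simp: card_1_singleton_iff)
        then have "p \<in> x" "d \<in> {1..n} - x" "y = insert d (x - {p})"
          using y by blast+
        then show "y \<in> ?L"
          by auto
      qed
    qed
  qed
qed

text \<open>Zero row sums turn each sum of weights leaving \<open>x\<close> into minus a sum inside
  \<open>x\<close>. Every term of the exchange formula then becomes a multiple of the weight of
  \<open>x\<close>.\<close>

lemma pair_weight_in_V2:
  assumes sym: "\<And>a b. g a b = g b a" and diag: "\<And>a. g a a = 0"
    and rows: "\<And>a. a \<in> {1..n} \<Longrightarrow> (\<Sum>b\<in>{1..n}. g a b) = 0"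
  shows "restrict (pair_weight g) (johnson_vertices n) \<in> V2 n"
proof -
  have "(\<Sum>y\<in>johnson_vertices n. adjacency_matrix x y * pair_weight g y) =
      (real n - 7) * pair_weight g x" if "x \<in> johnson_vertices n" for x
  proof -
    let ?W = "pair_weight g x"
    have x: "x \<subseteq> {1..n}" "card x = 3" "finite x"
      using that by (auto simp: johnson_vertices_def intro: card_ge_0_finite)
    have "3 \<le> n"
      using card_mono[OF _ x(1)] x(2) by simp
    then have card_compl: "real (card ({1..n} - x)) = real n - 3"
      using x by (simp add: card_Diff_subset)
    have compl: "(\<Sum>d\<in>{1..n} - x. g p d) = - (\<Sum>q\<in>x. g p q)" if "p \<in> x" for p
    proof -
      have "p \<in> {1..n}" using that x by auto
      then show ?thesis
        using x rows[of p] by (simp add: sum_diff)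
    qed
    have cross: "(\<Sum>p\<in>x. \<Sum>d\<in>{1..n} - x. g p d) = - ?W"
      using compl by (simp add: pair_weight_def sum_negf)
    have cross': "(\<Sum>d\<in>{1..n} - x. \<Sum>q\<in>x. g d q) = - ?W"
      using cross by (subst sum.swap) (simp add: sym)
    have "(\<Sum>y\<in>johnson_vertices n. adjacency_matrix x y * pair_weight g y) =
        (\<Sum>y\<in>{y \<in> johnson_vertices n. johnson_adjacent x y}. pair_weight g y)"
      by (simp add: adjacency_matrix_def sum.inter_filter if_distrib[of "\<lambda>c. c * _"] cong: if_cong)
    also have "\<dots> = (\<Sum>(p, d)\<in>x \<times> ({1..n} - x). pair_weight g (insert d (x - {p})))"
      by (subst sum.reindex_bij_betw[OF johnson_neighbours_bij_betw[OF that], symmetric])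
        (simp add: case_prod_unfold)
    also have "\<dots> = (\<Sum>(p, d)\<in>x \<times> ({1..n} - x).
        ?W - 2 * (\<Sum>q\<in>x. g p q) + 2 * (\<Sum>q\<in>x. g d q) - 2 * g p d)"
      using x sym diag by (intro sum.cong refl) (auto intro!: pair_weight_exchange)
    also have "\<dots> = (\<Sum>p\<in>x. \<Sum>d\<in>{1..n} - x.
        ?W - 2 * (\<Sum>q\<in>x. g p q) + 2 * (\<Sum>q\<in>x. g d q) - 2 * g p d)"
      by (rule sum.cartesian_product[symmetric])
    \<comment> \<open>A term depending only on \<open>p\<close> is repeated \<open>n - 3\<close>
      times, one depending only on \<open>d\<close> is repeated 3 times, and the constant
      \<open>?W\<close> occurs \<open>3 * (n - 3)\<close> times.\<close>
    also have "\<dots> = 3 * (real n - 3) * ?W - 2 * (real n - 3) * ?W + 2 * 3 * (- ?W) - 2 * (- ?W)"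
      unfolding sum.distrib sum_subtractf sum_distrib_left[symmetric] cross cross'
      using x(2) card_compl
      by (simp add: pair_weight_def[symmetric] sum_distrib_left[symmetric] mult.assoc)
        (simp add: algebra_simps)
    also have "\<dots> = (real n - 7) * ?W"
      by (simp add: algebra_simps)
    finally show ?thesis .
  qed
  then show ?thesis
    by (simp add: V2_def johnson_eigenspace_def)
qed

lemma m2_neg_le:
  assumes "v \<in> V2 n" "X_zero n v = {}"
  shows "m2_neg n \<le> card (X_neg n v)"
  unfolding m2_neg_def
proof (rule Min_le)
  show "finite {card (X_neg n v) | v. v \<in> V2 n \<and> X_zero n v = {}}"
    by (rule finite_subset[of _ "{..card (johnson_vertices n)}"])
      (auto simp: X_neg_def intro!: card_mono)
qed (use assms in auto)

section \<open>The weighting given by a matching\<close>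

text \<open>The matching edges are the pairs \<open>{2 * i - 1, 2 * i}\<close>. Truncated
  subtraction makes 0 a fixed point, whence \<open>1 \<le> a\<close> in
  \<open>partner_neq\<close>.\<close>

definition partner :: "nat \<Rightarrow> nat" where
  "partner a = (if odd a then a + 1 else a - 1)"

definition matching_weight :: "nat \<Rightarrow> nat \<Rightarrow> nat \<Rightarrow> real" where
  "matching_weight m a b =
    (if a \<in> {1..2 * m} \<and> b \<in> {1..2 * m} \<and> a \<noteq> b
     then if b = partner a then 2 - 2 * real m else 1 else 0)"

lemma partner_partner: "1 \<le> a \<Longrightarrow> partner (partner a) = a"
  by (auto simp: partner_def)

lemma partner_neq: "1 \<le> a \<Longrightarrow> partner a \<noteq> a"
  by (auto simp: partner_def)

lemma partner_mem: "a \<in> {1..2 * m} \<Longrightarrow> partner a \<in> {1..2 * m}"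
  unfolding partner_def atLeastAtMost_iff by presburger

lemma matching_weight_commute: "matching_weight m a b = matching_weight m b a"
  using partner_partner[of a] partner_partner[of b] by (auto simp: matching_weight_def)

lemma matching_weight_self: "matching_weight m a a = 0"
  by (simp add: matching_weight_def)

text \<open>The weight \<open>2 - 2 * m\<close> of a matching edge balances the
  \<open>2 * m - 2\<close> edges of weight 1 at the same point.\<close>

lemma sum_matching_weight:
  assumes "2 * m \<le> n"
  shows "(\<Sum>b\<in>{1..n}. matching_weight m a b) = 0"
proof (cases "a \<in> {1..2 * m}")
  case False
  then show ?thesis
    by (auto simp: matching_weight_def)
next
  case True
  let ?I = "{1..2 * m}"
  have p: "partner a \<in> ?I" "partner a \<noteq> a"
    using partner_mem[OF True] partner_neq True by auto
  have "(\<Sum>b\<in>{1..n}. matching_weight m a b) = (\<Sum>b\<in>?I. matching_weight m a b)"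
    by (rule sum.mono_neutral_right) (use assms in \<open>auto simp: matching_weight_def\<close>)
  \<comment> \<open>Constant weight 1, lowered to 0 at \<open>a\<close> and to
    \<open>2 - 2 * m\<close> at its partner.\<close>
  also have "\<dots> = (\<Sum>b\<in>?I. 1 - (if b = a then 1 else 0)
      - (if b = partner a then 2 * real m - 1 else 0))"
    by (rule sum.cong) (use True p in \<open>auto simp: matching_weight_def\<close>)
  also have "\<dots> = 0"
    unfolding sum_subtractf using True p by simp
  finally show ?thesis .
qed

text \<open>The two edges at \<open>c\<close> contribute at most 2, so the three edges total at most
  \<open>4 - 2 * m\<close>, which is negative for \<open>m \<ge> 3\<close>.\<close>

lemma pair_weight_matching_neg:
  assumes "3 \<le> m" "a \<in> {1..2 * m}" "c \<noteq> a" "c \<noteq> partner a"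
  shows "pair_weight (matching_weight m) {a, partner a, c} < 0"
proof -
  have p: "partner a \<in> {1..2 * m}" "partner a \<noteq> a" "partner (partner a) = a"
    using partner_mem[OF assms(2)] partner_neq partner_partner assms(2) by auto
  have "pair_weight (matching_weight m) {a, partner a, c} = 2 * (matching_weight m a (partner a)
      + matching_weight m a c + matching_weight m (partner a) c)"
    by (rule pair_weight_triple)
      (use p assms in \<open>auto simp: matching_weight_self matching_weight_commute\<close>)
  then show ?thesis
    using assms p by (auto simp: matching_weight_def)
qed

text \<open>Without a matching edge all weights are 0 or 1. As \<open>n \<le> 2 * m + 1\<close>, at
  least two points of the triple are matched, and their edge has weight 1.\<close>

lemma pair_weight_matching_pos:
  assumes "n \<le> 2 * m + 1" "x \<in> johnson_vertices n"
    and free: "\<And>a. a \<in> x \<Longrightarrow> a \<in> {1..2 * m} \<Longrightarrow> partner a \<notin> x"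
  shows "pair_weight (matching_weight m) x > 0"
proof -
  obtain a b c where x: "x = {a, b, c}" "a \<noteq> b" "a \<noteq> c" "b \<noteq> c" "x \<subseteq> {1..n}"
    using assms(2) by (auto simp: johnson_vertices_def card_3_iff)
  have w: "matching_weight m p q = (if p \<in> {1..2 * m} \<and> q \<in> {1..2 * m} then 1 else 0)"
    if "p \<in> x" "q \<in> x" "p \<noteq> q" for p q
    using that free[of p] by (auto simp: matching_weight_def)
  have "pair_weight (matching_weight m) x =
      2 * (matching_weight m a b + matching_weight m a c + matching_weight m b c)"
    unfolding x(1) by (rule pair_weight_triple)
      (use x in \<open>auto simp: matching_weight_self matching_weight_commute\<close>)
  moreover have "matching_weight m a b + matching_weight m a c + matching_weight m b c > 0"
    using x assms(1) by (auto simp: w)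
  ultimately show ?thesis
    by simp
qed

section \<open>Counting the negative triples\<close>

lemma m2_neg_le_matching:
  assumes "3 \<le> m" "2 * m \<le> n" "n \<le> 2 * m + 1"
  shows "m2_neg n \<le> m * (n - 2)"
proof -
  let ?W = "pair_weight (matching_weight m)"
  let ?v = "restrict ?W (johnson_vertices n)"
  let ?P = "SIGMA i:{1..m}. {1..n} - {2 * i - 1, 2 * i}"
  have matched: "\<exists>i\<in>{1..m}. \<exists>c\<in>{1..n} - {2 * i - 1, 2 * i}. x = {2 * i - 1, 2 * i, c}"
    and neg: "?W x < 0"
    if x: "x \<in> johnson_vertices n" "a \<in> x" "a \<in> {1..2 * m}" "partner a \<in> x" for x a
  proof -
    have "card x = 3" "x \<subseteq> {1..n}" "partner a \<noteq> a"
      using x partner_neq by (auto simp: johnson_vertices_def)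
    then have "card (x - {a, partner a}) = 1"
      using x by (simp add: card_Diff_subset)
    then obtain c where "x - {a, partner a} = {c}"
      by (auto simp: card_1_singleton_iff)
    then have c: "x = {a, partner a, c}" "c \<noteq> a" "c \<noteq> partner a" "c \<in> {1..n}"
      using x \<open>x \<subseteq> {1..n}\<close> by blast+
    then show "?W x < 0"
      using pair_weight_matching_neg assms x by simp
    \<comment> \<open>The index of the matching edge at \<open>a\<close>, whichever of its two ends
      \<open>a\<close> is.\<close>
    define i where "i = (a + 1) div 2"
    have i: "i \<in> {1..m}" "{a, partner a} = {2 * i - 1, 2 * i}"
      using x(3) by (auto simp: i_def partner_def elim!: evenE oddE)
    moreover have "x = {2 * i - 1, 2 * i, c}" "c \<notin> {2 * i - 1, 2 * i}"
      using c i(2) by auto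
    ultimately show "\<exists>i\<in>{1..m}. \<exists>c\<in>{1..n} - {2 * i - 1, 2 * i}. x = {2 * i - 1, 2 * i, c}"
      using c(4) by blast
  qed
  have pos: "?W x > 0"
    if "x \<in> johnson_vertices n" "\<And>a. a \<in> x \<Longrightarrow> a \<in> {1..2 * m} \<Longrightarrow> partner a \<notin> x" for x
    using pair_weight_matching_pos assms that by blast
  have "?v \<in> V2 n"
    by (rule pair_weight_in_V2)
      (simp_all only: matching_weight_commute matching_weight_self sum_matching_weight[OF assms(2)])
  moreover have "X_zero n ?v = {}"
    using neg pos by (fastforce simp: X_zero_def)
  ultimately have "m2_neg n \<le> card (X_neg n ?v)"
    by (rule m2_neg_le)
  \<comment> \<open>Each negative triple is coded by the index of a matching edge in it and its
    third point. For an upper bound it is enough that these codes cover all negative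
    triples.\<close>
  also have "X_neg n ?v \<subseteq> (\<lambda>(i, c). {2 * i - 1, 2 * i, c}) ` ?P"
  proof
    fix x assume "x \<in> X_neg n ?v"
    then have x: "x \<in> johnson_vertices n" "?W x < 0"
      by (auto simp: X_neg_def)
    then obtain a where "a \<in> x" "a \<in> {1..2 * m}" "partner a \<in> x"
      using pos by fastforce
    from matched[OF x(1) this] show "x \<in> (\<lambda>(i, c). {2 * i - 1, 2 * i, c}) ` ?P"
      by force
  qed
  then have "card (X_neg n ?v) \<le> card ?P"
    by (rule surj_card_le[rotated]) simp
  also have "card ?P = (\<Sum>i\<in>{1..m}. n - 2)"
  proof -
    have "card ({1..n} - {2 * i - 1, 2 * i}) = n - 2" if "i \<in> {1..m}" for i
    proof -
      have "{2 * i - 1, 2 * i} \<subseteq> {1..n}" "2 * i - 1 \<noteq> 2 * i"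
        using that assms(2) by auto
      then show ?thesis
        by (simp add: card_Diff_subset)
    qed
    then show ?thesis
      by simp
  qed
  finally show ?thesis
    by simp
qed

theorem theorem3:
  fixes n :: nat
  assumes "n \<ge> 6"
  shows "real (m2_neg n) \<le>
    (if even n then real n * (real n - 2) / 2 else (real n - 1) * (real n - 2) / 2)"
proof -
  \<comment> \<open>A largest matching on \<open>n\<close> points has \<open>n div 2\<close> edges,
    and \<open>n \<ge> 6\<close> makes this at least 3.\<close>
  define m where "m = n div 2"
  have "m2_neg n \<le> m * (n - 2)"
    by (rule m2_neg_le_matching) (use assms in \<open>auto simp: m_def\<close>)
  then have "real (m2_neg n) \<le> real (m * (n - 2))"
    by linarith
  also have "\<dots> = real m * (real n - 2)"
    using assms by (simp add: of_nat_diff)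
  also have "real m = (if even n then real n / 2 else (real n - 1) / 2)"
    by (auto simp: m_def elim!: evenE oddE)
  finally show ?thesis
    by (auto split: if_splits)
qed

end
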